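(* Let $(\Omega,P,\pi)$ be a finite irreducible reversible Markov chain (in continuous time) and $\mu$ a probability distribution on $\Omega$. Then for any $0<\epsilon<\delta<1$ and any $0<\beta\le\gamma<1$, $$\mathrm{hit}_{\gamma,\mu}(\delta)\le \mathrm{hit}_{\beta,\mu}(\delta)\le \mathrm{hit}_{\gamma,\mu}(\delta-\epsilon)+\beta^{-1}t_{\mathrm{rel}}\log\Big(\frac{1-\beta}{(1-\gamma)\epsilon}\Big).$$
   Context: Continuous-time chain with heat kernel $H_t(x,y)=\sum_{k\ge0}e^{-t}\frac{t^k}{k!}P^k(x,y)$; reversible means $\pi(x)P(x,y)=\pi(y)P(y,x)$. $\mathrm P_\mu$: law of the chain with $X_0\sim\mu$. $t_{\mathrm{rel}}:=(1-\lambda_2)^{-1}$, $\lambda_2$ the second largest eigenvalue of $P$. $T_B:=\inf\{t\ge0:X_t\in B\}$; $\mathrm{hit}_{\delta,\mu}(q):=\inf\{t\ge0:\max_{B:\pi(B)\ge\delta}\mathrm P_\mu[T_B>t]\le q\}$. *)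

theory Defs
  imports Complex_Main
begin

(* Transition matrices on a finite state space 'a are functions 'a => 'a => real. *)

definition stochastic :: "('a::finite \<Rightarrow> 'a \<Rightarrow> real) \<Rightarrow> bool" where
  "stochastic P \<longleftrightarrow> (\<forall>x y. 0 \<le> P x y) \<and> (\<forall>x. (\<Sum>y\<in>UNIV. P x y) = 1)"

definition prob_dist :: "('a::finite \<Rightarrow> real) \<Rightarrow> bool" where
  "prob_dist \<mu> \<longleftrightarrow> (\<forall>x. 0 \<le> \<mu> x) \<and> (\<Sum>x\<in>UNIV. \<mu> x) = 1"

fun mpow :: "('a::finite \<Rightarrow> 'a \<Rightarrow> real) \<Rightarrow> nat \<Rightarrow> 'a \<Rightarrow> 'a \<Rightarrow> real" where
  "mpow P 0 x y = (if x = y then 1 else 0)"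
| "mpow P (Suc k) x y = (\<Sum>z\<in>UNIV. P x z * mpow P k z y)"

definition irreducible_chain :: "('a::finite \<Rightarrow> 'a \<Rightarrow> real) \<Rightarrow> bool" where
  "irreducible_chain P \<longleftrightarrow> (\<forall>x y. \<exists>k. mpow P k x y > 0)"

definition reversible_wrt :: "('a::finite \<Rightarrow> 'a \<Rightarrow> real) \<Rightarrow> ('a \<Rightarrow> real) \<Rightarrow> bool" where
  "reversible_wrt P \<pi> \<longleftrightarrow> (\<forall>x y. \<pi> x * P x y = \<pi> y * P y x)"

(* real eigenvalue of P (P acting on column vectors) *)
definition is_eigenvalue :: "('a::finite \<Rightarrow> 'a \<Rightarrow> real) \<Rightarrow> real \<Rightarrow> bool" where
  "is_eigenvalue P l \<longleftrightarrow> (\<exists>v::'a \<Rightarrow> real. v \<noteq> (\<lambda>_. 0) \<and> (\<forall>x. (\<Sum>y\<in>UNIV. P x y * v y) = l * v x))"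

(* second largest eigenvalue: for an irreducible chain the eigenvalue 1 is simple and
   the largest, so lambda_2 is the largest eigenvalue different from 1 *)
definition lambda2 :: "('a::finite \<Rightarrow> 'a \<Rightarrow> real) \<Rightarrow> real" where
  "lambda2 P = Max {l. is_eigenvalue P l \<and> l \<noteq> 1}"

definition t_rel :: "('a::finite \<Rightarrow> 'a \<Rightarrow> real) \<Rightarrow> real" where
  "t_rel P = 1 / (1 - lambda2 P)"

(* avoid P B k x = probability that the discrete-time chain started at x
   stays outside B at steps 0,1,...,k *)
fun avoid :: "('a::finite \<Rightarrow> 'a \<Rightarrow> real) \<Rightarrow> 'a set \<Rightarrow> nat \<Rightarrow> 'a \<Rightarrow> real" where
  "avoid P B 0 x = (if x \<in> B then 0 else 1)"
| "avoid P B (Suc k) x = (if x \<in> B then 0 else (\<Sum>y\<in>UNIV. P x y * avoid P B k y))"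

(* P_mu[T_B > t] for the continuous-time (rate-1 Poissonised) chain with heat kernel
   H_t = sum_k e^{-t} t^k/k! P^k: the chain avoids B up to time t iff the
   embedded discrete chain avoids B during its first N_t steps, N_t ~ Poisson(t). *)
definition survival :: "('a::finite \<Rightarrow> 'a \<Rightarrow> real) \<Rightarrow> ('a \<Rightarrow> real) \<Rightarrow> 'a set \<Rightarrow> real \<Rightarrow> real" where
  "survival P \<mu> B t = (\<Sum>x\<in>UNIV. \<mu> x * (\<Sum>k. exp (- t) * t ^ k / fact k * avoid P B k x))"

(* hit_{delta,mu}(q) = inf { t >= 0 : max_{B : pi(B) >= delta} P_mu[T_B > t] <= q } *)
definition hit :: "('a::finite \<Rightarrow> 'a \<Rightarrow> real) \<Rightarrow> ('a \<Rightarrow> real) \<Rightarrow> real \<Rightarrow> ('a \<Rightarrow> real) \<Rightarrow> real \<Rightarrow> real" where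
  "hit P \<pi> \<delta> \<mu> q = Inf {t. 0 \<le> t \<and> (\<forall>B. sum \<pi> B \<ge> \<delta> \<longrightarrow> survival P \<mu> B t \<le> q)}"

end

theory Submission
  imports Defs "HOL-Analysis.Analysis"
begin

text \<open>The first inequality holds because \<open>hit\<close> is monotone in the size threshold. For the
  second, fix \<open>B\<close> with \<open>\<pi>(B) \<ge> \<beta>\<close> and let \<open>s = \<beta>\<^sup>-\<^sup>1 t_rel log ((1 - \<beta>) / ((1 - \<gamma>) \<epsilon>))\<close>.
  By the spectral gap of the symmetrised chain killed on \<open>B\<close>, the stationary chain avoids \<open>B\<close>
  up to time \<open>s\<close> with probability at most \<open>(1 - \<pi>(B)) exp (- s \<pi>(B) / t_rel) \<le> (1 - \<gamma>) \<epsilon>\<close>.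
  By Markov's inequality, the set \<open>A\<close> of states from which \<open>B\<close> is avoided up to time \<open>s\<close>
  with probability at most \<open>\<epsilon>\<close> has \<open>\<pi>(A) \<ge> \<gamma>\<close>, so it is hit before time
  \<open>hit\<^sub>\<gamma>(\<delta> - \<epsilon>)\<close> except with probability \<open>\<delta> - \<epsilon>\<close>; the strong Markov property at the
  hitting time of \<open>A\<close> then bounds the probability of avoiding \<open>B\<close> up to time
  \<open>hit\<^sub>\<gamma>(\<delta> - \<epsilon>) + s\<close> by \<open>\<delta>\<close>.\<close>

definition poisson_weight :: "real \<Rightarrow> nat \<Rightarrow> real" where
  "poisson_weight t k = exp (- t) * t ^ k / fact k"

lemma poisson_weight_nonneg: "0 \<le> t \<Longrightarrow> 0 \<le> poisson_weight t k"
  by (simp add: poisson_weight_def)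

lemma poisson_weight_power_sums:
  "(\<lambda>k. poisson_weight t k * c ^ k) sums (exp (- t) * exp (t * c))"
proof -
  have "(\<lambda>k. exp (- t) * ((t * c) ^ k /\<^sub>R fact k)) sums (exp (- t) * exp (t * c))"
    by (intro sums_mult exp_converges)
  then show ?thesis
    by (simp add: poisson_weight_def power_mult_distrib divide_inverse_commute mult_ac)
qed

lemma poisson_weight_sums_1: "poisson_weight t sums 1"
  using poisson_weight_power_sums[of t 1] by (simp add: exp_minus field_simps)

lemma summable_poisson_weight_bounded:
  assumes "0 \<le> t" and "\<And>k. \<bar>b k\<bar> \<le> 1"
  shows "summable (\<lambda>k. poisson_weight t k * b k)"
proof (rule summable_comparison_test[OF _ sums_summable[OF poisson_weight_sums_1]])
  show "\<exists>N. \<forall>k\<ge>N. norm (poisson_weight t k * b k) \<le> poisson_weight t k"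
    using assms by (auto simp: abs_mult poisson_weight_nonneg intro!: mult_left_le)
qed

lemma poisson_weight_add:
  "poisson_weight (t + s) n = (\<Sum>i\<le>n. poisson_weight t i * poisson_weight s (n - i))"
proof -
  have "poisson_weight (t + s) n = exp (- t) * exp (- s) * ((t + s) ^ n / fact n)"
    by (simp add: poisson_weight_def exp_add[symmetric])
  also have "(t + s) ^ n / fact n = (\<Sum>i\<le>n. of_nat (n choose i) * t ^ i * s ^ (n - i) / fact n)"
    by (subst binomial_ring) (simp add: sum_divide_distrib)
  also have "\<dots> = (\<Sum>i\<le>n. t ^ i / fact i * (s ^ (n - i) / fact (n - i)))"
    by (intro sum.cong refl) (simp add: binomial_fact field_simps)
  finally show ?thesis
    by (simp add: poisson_weight_def sum_distrib_left mult_ac)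
qed

lemma poisson_mixture_product_sums:
  assumes "0 \<le> t" "0 \<le> s" "\<And>i. \<bar>a i\<bar> \<le> 1" "\<And>j. \<bar>b j\<bar> \<le> 1"
  shows "(\<lambda>n. \<Sum>i\<le>n. poisson_weight t i * a i * (poisson_weight s (n - i) * b (n - i)))
    sums ((\<Sum>i. poisson_weight t i * a i) * (\<Sum>j. poisson_weight s j * b j))"
proof (rule Cauchy_product_sums)
  show "summable (\<lambda>i. norm (poisson_weight t i * a i))"
    using summable_poisson_weight_bounded[of t "\<lambda>i. \<bar>a i\<bar>"] assms
    by (simp add: abs_mult poisson_weight_nonneg)
  show "summable (\<lambda>j. norm (poisson_weight s j * b j))"
    using summable_poisson_weight_bounded[of s "\<lambda>j. \<bar>b j\<bar>"] assms
    by (simp add: abs_mult poisson_weight_nonneg)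
qed

lemma symmetric_matrix_inner:
  fixes A :: "real^'n^'n"
  assumes "transpose A = A"
  shows "(A *v x) \<bullet> y = x \<bullet> (A *v y)"
  by (metis assms dot_lmul_matrix vector_transpose_matrix)

lemma symmetric_matrix_rayleigh_maximiser:
  fixes A :: "real^'n^'n"
  assumes sym: "transpose A = A" and V: "subspace V" "\<And>v. v \<in> V \<Longrightarrow> A *v v \<in> V"
    and e: "e \<in> V" "e \<bullet> e = 1"
    and rayleigh: "\<And>y. y \<in> V \<Longrightarrow> y \<bullet> (A *v y) \<le> (e \<bullet> (A *v e)) * (y \<bullet> y)"
  shows "A *v e = (e \<bullet> (A *v e)) *\<^sub>R e"
proof -
  define M where "M = e \<bullet> (A *v e)"
  define d where "d = A *v e - M *\<^sub>R e"
  have dV: "d \<in> V"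
    unfolding d_def using V e by (simp add: subspace_diff subspace_scale)
  define K where "K = M * (d \<bullet> d) - d \<bullet> (A *v d)"
  have K: "K \<ge> 0"
    using rayleigh[OF dV] by (simp add: K_def M_def)
  have small: "d \<bullet> d \<le> t * K / 2" if "t > 0" for t
  proof -
    have "e + t *\<^sub>R d \<in> V"
      using e dV V by (simp add: subspace_add subspace_scale)
    from rayleigh[OF this] symmetric_matrix_inner[OF sym, of d e]
    have "2 * t * (d \<bullet> d) + t\<^sup>2 * (d \<bullet> (A *v d) - M * (d \<bullet> d)) \<le> 0"
      by (simp add: d_def M_def e(2) matrix_vector_right_distrib matrix_vector_mult_scaleR
          inner_add_left inner_add_right inner_diff_left inner_diff_right inner_commute
          algebra_simps power2_eq_square)
    then have "t * (2 * (d \<bullet> d) - t * K) \<le> 0"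
      by (simp add: K_def power2_eq_square algebra_simps)
    with that show ?thesis
      by (simp add: mult_le_0_iff)
  qed
  have "d \<bullet> d \<le> 0"
  proof (rule ccontr)
    assume "\<not> d \<bullet> d \<le> 0"
    then have pos: "0 < d \<bullet> d"
      by linarith
    have "d \<bullet> d \<le> d \<bullet> d * (K / (2 * (K + 1)))"
      using small[of "d \<bullet> d / (K + 1)"] pos K by (simp add: mult.commute)
    also have "\<dots> < d \<bullet> d"
      using mult_strict_left_mono[OF _ pos, of "K / (2 * (K + 1))" 1] K by simp
    finally show False
      by simp
  qed
  then have "d = 0"
    using inner_gt_zero_iff[of d] by linarith
  then show ?thesis
    by (simp add: d_def M_def)
qed

lemma symmetric_matrix_eigenvector_in_subspace:
  fixes A :: "real^'n^'n"
  assumes sym: "transpose A = A" and V: "subspace V" "\<And>v. v \<in> V \<Longrightarrow> A *v v \<in> V"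
    and u: "u \<in> V" "u \<noteq> 0"
  obtains e c where "e \<in> V" "e \<noteq> 0" "A *v e = c *\<^sub>R e"
proof -
  let ?K = "sphere 0 1 \<inter> V"
  have "compact ?K"
    by (rule compact_Int_closed[OF compact_sphere closed_subspace[OF V(1)]])
  moreover have "u /\<^sub>R norm u \<in> ?K"
    using u V by (simp add: subspace_scale)
  moreover have "continuous_on ?K (\<lambda>y. y \<bullet> (A *v y))"
    by (intro continuous_intros linear_continuous_on) (simp add: linear_conv_bounded_linear)
  ultimately obtain e where e: "e \<in> ?K" and emax: "\<And>y. y \<in> ?K \<Longrightarrow> y \<bullet> (A *v y) \<le> e \<bullet> (A *v e)"
    using continuous_attains_sup[of ?K] by blast
  have rayleigh: "y \<bullet> (A *v y) \<le> (e \<bullet> (A *v e)) * (y \<bullet> y)" if "y \<in> V" for y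
  proof (cases "y = 0")
    case False
    then have "(y /\<^sub>R norm y) \<bullet> (A *v (y /\<^sub>R norm y)) \<le> e \<bullet> (A *v e)"
      using emax[of "y /\<^sub>R norm y"] that V by (simp add: subspace_scale)
    then show ?thesis
      using False by (simp add: matrix_vector_mult_scaleR power2_norm_eq_inner[symmetric]
          power2_eq_square field_simps)
  qed simp
  have "e \<in> V" "e \<bullet> e = 1"
    using e by (auto simp: dot_square_norm)
  with symmetric_matrix_rayleigh_maximiser[OF sym V _ _ rayleigh] that show ?thesis
    by fastforce
qed

lemma symmetric_matrix_spectral_decomposition:
  fixes A :: "real^'n^'n"
  assumes sym: "transpose A = A"
  shows "subspace V \<Longrightarrow> (\<And>v. v \<in> V \<Longrightarrow> A *v v \<in> V) \<Longrightarrow> h \<in> V \<Longrightarrow>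
    \<exists>E. finite E \<and> E \<subseteq> V \<and> pairwise orthogonal E \<and> (\<forall>e\<in>E. \<exists>c. A *v e = c *\<^sub>R e) \<and> h = \<Sum>E"
proof (induction "dim V" arbitrary: V h rule: less_induct)
  case less
  show ?case
  proof (cases "V \<subseteq> {0}")
    case True
    with less.prems show ?thesis
      by (intro exI[of _ "{}"]) auto
  next
    case False
    then obtain u where "u \<in> V" "u \<noteq> 0"
      by blast
    then obtain e c where e: "e \<in> V" "e \<noteq> 0" "A *v e = c *\<^sub>R e"
      using symmetric_matrix_eigenvector_in_subspace[OF sym less.prems(1,2)] by blast
    define W where "W = V \<inter> {y. orthogonal e y}"
    have W: "subspace W"
      unfolding W_def by (intro subspace_inter less.prems(1) subspace_orthogonal_to_vector)
    have W_inv: "A *v w \<in> W" if "w \<in> W" for w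
      using that less.prems(2) symmetric_matrix_inner[OF sym, of e w] e(3)
      by (auto simp: W_def orthogonal_def)
    have "e \<notin> W"
      using e(2) by (simp add: W_def orthogonal_def)
    with e(1) have "W \<subset> V"
      by (auto simp: W_def)
    then have "dim W < dim V"
      using W less.prems(1) by (intro dim_psubset) (simp add: span_eq_iff[THEN iffD2])
    define a where "a = (h \<bullet> e) / (e \<bullet> e)"
    have "h - a *\<^sub>R e \<in> W"
      using less.prems(1,3) e(1,2)
      by (simp add: W_def orthogonal_def a_def subspace_diff subspace_scale inner_diff_right inner_commute)
    then obtain E where E: "finite E" "E \<subseteq> W" "pairwise orthogonal E"
        "\<forall>e\<in>E. \<exists>c. A *v e = c *\<^sub>R e" "h - a *\<^sub>R e = \<Sum>E"
      using less.hyps[OF \<open>dim W < dim V\<close> W W_inv] by blast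
    have orth: "orthogonal (a *\<^sub>R e) y" if "y \<in> E" for y
      using that E(2) by (auto simp: W_def orthogonal_def)
    then have "a *\<^sub>R e \<in> E \<Longrightarrow> a *\<^sub>R e = 0"
      by (metis orthogonal_self)
    then have "h = \<Sum>(insert (a *\<^sub>R e) E)"
      using E(1,5) by (auto simp: sum.insert_if algebra_simps)
    moreover have "pairwise orthogonal (insert (a *\<^sub>R e) E)"
      using E(3) orth by (simp add: pairwise_insert orthogonal_commute)
    ultimately show ?thesis
      using E(1,2,4) e less.prems(1) \<open>W \<subset> V\<close>
      by (intro exI[of _ "insert (a *\<^sub>R e) E"]) (auto simp: subspace_scale matrix_vector_mult_scaleR)
  qed
qed

lemma symmetric_matrix_eigen_expansion:
  fixes A :: "real^'n^'n"
  assumes sym: "transpose A = A" and V: "subspace V" "\<And>v. v \<in> V \<Longrightarrow> A *v v \<in> V" and "h \<in> V"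
    and spectrum_le: "\<And>e c. e \<in> V \<Longrightarrow> e \<noteq> 0 \<Longrightarrow> A *v e = c *\<^sub>R e \<Longrightarrow> c \<le> m"
  obtains E c where "finite E" "pairwise orthogonal E" "h = \<Sum>E"
    "\<forall>e\<in>E. A *v e = c e *\<^sub>R e" "\<forall>e\<in>E. c e \<le> m"
proof -
  obtain E where E: "finite E" "E \<subseteq> V" "pairwise orthogonal E"
      "\<forall>e\<in>E. \<exists>c. A *v e = c *\<^sub>R e" "h = \<Sum>E"
    using symmetric_matrix_spectral_decomposition[OF sym V \<open>h \<in> V\<close>] by blast
  define c where "c e = (if e = 0 then m else SOME c. A *v e = c *\<^sub>R e)" for e
  have "A *v e = c e *\<^sub>R e \<and> c e \<le> m" if "e \<in> E" for e
  proof (cases "e = 0")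
    case False
    with someI_ex[of "\<lambda>c. A *v e = c *\<^sub>R e"] E(2,4) that show ?thesis
      by (auto simp: c_def intro: spectrum_le)
  qed (simp add: c_def)
  with E show thesis
    by (intro that[of E c]) auto
qed

lemma inner_sum_orthogonal:
  fixes E :: "'a::real_inner set"
  assumes "finite E" "pairwise orthogonal E"
  shows "(\<Sum>E) \<bullet> (\<Sum>e\<in>E. c e *\<^sub>R e) = (\<Sum>e\<in>E. c e * (e \<bullet> e))"
proof -
  have "(\<Sum>E) \<bullet> (\<Sum>e\<in>E. c e *\<^sub>R e) = (\<Sum>x\<in>E. \<Sum>y\<in>E. c y * (x \<bullet> y))"
    by (simp add: inner_sum_left inner_sum_right sum_distrib_left mult_ac) (rule sum.swap)
  also have "\<dots> = (\<Sum>x\<in>E. c x * (x \<bullet> x))"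
  proof (rule sum.cong[OF refl])
    fix x assume "x \<in> E"
    with assms have "(\<Sum>y\<in>E. c y * (x \<bullet> y)) = (\<Sum>y\<in>{x}. c y * (x \<bullet> y))"
      by (intro sum.mono_neutral_right) (auto simp: pairwise_def orthogonal_def)
    then show "(\<Sum>y\<in>E. c y * (x \<bullet> y)) = c x * (x \<bullet> x)"
      by simp
  qed
  finally show ?thesis .
qed

lemma inner_matrix_power_eigen_expansion:
  fixes A :: "real^'n^'n"
  assumes "finite E" "pairwise orthogonal E" "h = \<Sum>E" "\<forall>e\<in>E. A *v e = c e *\<^sub>R e"
  shows "h \<bullet> ((*v) A ^^ k) h = (\<Sum>e\<in>E. c e ^ k * (e \<bullet> e))"
proof -
  have "((*v) A ^^ k) h = (\<Sum>e\<in>E. c e ^ k *\<^sub>R e)"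
    using assms(3,4)
    by (induction k) (simp_all add: linear_sum[OF matrix_vector_mul_linear] matrix_vector_mult_scaleR mult.commute)
  then show ?thesis
    using inner_sum_orthogonal[OF assms(1,2)] assms(3) by simp
qed

lemma symmetric_matrix_quadratic_form_le:
  fixes A :: "real^'n^'n"
  assumes sym: "transpose A = A" and V: "subspace V" "\<And>v. v \<in> V \<Longrightarrow> A *v v \<in> V" and "h \<in> V"
    and spectrum_le: "\<And>e c. e \<in> V \<Longrightarrow> e \<noteq> 0 \<Longrightarrow> A *v e = c *\<^sub>R e \<Longrightarrow> c \<le> m"
  shows "h \<bullet> (A *v h) \<le> m * (h \<bullet> h)"
proof -
  obtain E c where E: "finite E" "pairwise orthogonal E" "h = \<Sum>E"
      "\<forall>e\<in>E. A *v e = c e *\<^sub>R e" "\<forall>e\<in>E. c e \<le> m"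
    by (rule symmetric_matrix_eigen_expansion[OF assms])
  have "h \<bullet> (A *v h) = (\<Sum>e\<in>E. c e * (e \<bullet> e))"
    using inner_matrix_power_eigen_expansion[OF E(1-4), of 1] by simp
  also have "\<dots> \<le> (\<Sum>e\<in>E. m * (e \<bullet> e))"
    using E(5) by (intro sum_mono mult_right_mono) auto
  also have "\<dots> = m * (h \<bullet> h)"
    using inner_matrix_power_eigen_expansion[OF E(1-4), of 0] by (simp add: sum_distrib_left)
  finally show ?thesis .
qed

text \<open>The Poisson average of the powers of \<open>A\<close> is the heat semigroup \<open>exp (s (A - 1))\<close>.\<close>
lemma symmetric_matrix_poisson_form_le:
  fixes A :: "real^'n^'n"
  assumes sym: "transpose A = A" and V: "subspace V" "\<And>v. v \<in> V \<Longrightarrow> A *v v \<in> V" and "h \<in> V"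
    and spectrum_le: "\<And>e c. e \<in> V \<Longrightarrow> e \<noteq> 0 \<Longrightarrow> A *v e = c *\<^sub>R e \<Longrightarrow> c \<le> m"
    and "0 \<le> s"
  shows "(\<Sum>k. poisson_weight s k * (h \<bullet> ((*v) A ^^ k) h)) \<le> exp (- (s * (1 - m))) * (h \<bullet> h)"
proof -
  obtain E c where E: "finite E" "pairwise orthogonal E" "h = \<Sum>E"
      "\<forall>e\<in>E. A *v e = c e *\<^sub>R e" "\<forall>e\<in>E. c e \<le> m"
    by (rule symmetric_matrix_eigen_expansion[OF assms(1-5)])
  have "(\<lambda>k. \<Sum>e\<in>E. (e \<bullet> e) * (poisson_weight s k * c e ^ k))
        sums (\<Sum>e\<in>E. (e \<bullet> e) * (exp (- s) * exp (s * c e)))"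
    by (intro sums_sum sums_mult poisson_weight_power_sums)
  then have "(\<Sum>k. poisson_weight s k * (h \<bullet> ((*v) A ^^ k) h))
        = (\<Sum>e\<in>E. (e \<bullet> e) * (exp (- s) * exp (s * c e)))"
    by (simp add: inner_matrix_power_eigen_expansion[OF E(1-4)] sum_distrib_left mult_ac sums_iff)
  also have "\<dots> \<le> (\<Sum>e\<in>E. (e \<bullet> e) * exp (- (s * (1 - m))))"
  proof (intro sum_mono mult_left_mono)
    fix e assume "e \<in> E"
    then have "s * c e \<le> s * m"
      using E(5) \<open>0 \<le> s\<close> by (simp add: mult_left_mono)
    then show "exp (- s) * exp (s * c e) \<le> exp (- (s * (1 - m)))"
      by (simp add: exp_add[symmetric] algebra_simps)
  qed simp
  also have "\<dots> = exp (- (s * (1 - m))) * (h \<bullet> h)"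
    using inner_matrix_power_eigen_expansion[OF E(1-4), of 0] by (simp add: sum_distrib_right mult_ac)
  finally show ?thesis .
qed

lemma symmetric_matrix_eigenvalues_finite:
  fixes A :: "real^'n^'n"
  assumes sym: "transpose A = A"
  shows "finite {c. \<exists>v. v \<noteq> 0 \<and> A *v v = c *\<^sub>R v}"
proof -
  define L where "L = {c. \<exists>v. v \<noteq> 0 \<and> A *v v = c *\<^sub>R v}"
  define v where "v c = (SOME v. v \<noteq> 0 \<and> A *v v = c *\<^sub>R v)" for c
  have v: "v c \<noteq> 0" "A *v v c = c *\<^sub>R v c" if "c \<in> L" for c
    using someI_ex[of "\<lambda>v. v \<noteq> 0 \<and> A *v v = c *\<^sub>R v"] that by (auto simp: L_def v_def)
  have "v c \<bullet> v c' = 0" if "c \<in> L" "c' \<in> L" "c \<noteq> c'" for c c'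
  proof -
    have "c * (v c \<bullet> v c') = c' * (v c \<bullet> v c')"
      using symmetric_matrix_inner[OF sym, of "v c" "v c'"] v[OF that(1)] v[OF that(2)] by simp
    with that(3) show ?thesis
      by simp
  qed
  then have "pairwise orthogonal (v ` L)"
    by (auto simp: pairwise_def orthogonal_def)
  moreover have "0 \<notin> v ` L"
    using v by auto
  ultimately have "finite (v ` L)"
    by (intro finiteI_independent pairwise_orthogonal_independent)
  moreover have "inj_on v L"
  proof (rule inj_onI)
    fix c c' assume "c \<in> L" "c' \<in> L" "v c = v c'"
    then have "c *\<^sub>R v c = c' *\<^sub>R v c"
      using v by metis
    with v(1)[OF \<open>c \<in> L\<close>] show "c = c'"
      by simp
  qed
  ultimately show ?thesis
    unfolding L_def[symmetric] by (rule finite_imageD)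
qed

text \<open>\<open>first_entry P A i x y\<close> is the probability that the chain started at \<open>x\<close> enters \<open>A\<close>
  within \<open>i\<close> steps, and does so first at \<open>y\<close>.\<close>
fun first_entry :: "('a::finite \<Rightarrow> 'a \<Rightarrow> real) \<Rightarrow> 'a set \<Rightarrow> nat \<Rightarrow> 'a \<Rightarrow> 'a \<Rightarrow> real" where
  "first_entry P A 0 x y = (if x \<in> A \<and> y = x then 1 else 0)"
| "first_entry P A (Suc i) x y =
    (if x \<in> A then (if y = x then 1 else 0) else (\<Sum>z\<in>UNIV. P x z * first_entry P A i z y))"

definition survival_from :: "('a::finite \<Rightarrow> 'a \<Rightarrow> real) \<Rightarrow> 'a set \<Rightarrow> real \<Rightarrow> 'a \<Rightarrow> real" where
  "survival_from P B t x = (\<Sum>k. poisson_weight t k * avoid P B k x)"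

lemma avoid_eq_0: "x \<in> B \<Longrightarrow> avoid P B k x = 0"
  by (cases k) auto

lemma survival_eq_sum_survival_from:
  "survival P \<mu> B t = (\<Sum>x\<in>UNIV. \<mu> x * survival_from P B t x)"
  by (simp add: survival_def survival_from_def poisson_weight_def)

locale markov_chain =
  fixes P :: "'a::finite \<Rightarrow> 'a \<Rightarrow> real"
  assumes stochastic: "stochastic P"
begin

lemma P_nonneg: "0 \<le> P x y"
  using stochastic by (simp add: stochastic_def)

lemma P_row_sum: "(\<Sum>y\<in>UNIV. P x y) = 1"
  using stochastic by (simp add: stochastic_def)

lemma P_average_le: "(\<And>y. f y \<le> c) \<Longrightarrow> (\<Sum>y\<in>UNIV. P x y * f y) \<le> c"
  using sum_mono[of UNIV "\<lambda>y. P x y * f y" "\<lambda>y. P x y * c"]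
  by (simp add: P_nonneg mult_left_mono sum_distrib_right[symmetric] P_row_sum)

lemma P_average_nonneg: "(\<And>y. 0 \<le> f y) \<Longrightarrow> 0 \<le> (\<Sum>y\<in>UNIV. P x y * f y)"
  by (simp add: P_nonneg sum_nonneg)

lemma mpow_nonneg: "0 \<le> mpow P k x y"
  by (induction k arbitrary: x) (simp_all add: P_average_nonneg)

lemma avoid_nonneg: "0 \<le> avoid P B k x"
  by (induction k arbitrary: x) (simp_all add: P_average_nonneg)

lemma avoid_le_1: "avoid P B k x \<le> 1"
  by (induction k arbitrary: x) (simp_all add: P_average_le)

lemma avoid_Suc_le: "avoid P B (Suc k) x \<le> avoid P B k x"
proof (induction k arbitrary: x)
  case 0
  then show ?case
    by (simp add: P_average_le avoid_le_1)
next
  case (Suc k)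
  then show ?case
    by (auto intro!: sum_mono mult_left_mono P_nonneg)
qed

lemma avoid_antimono: "k \<le> n \<Longrightarrow> avoid P B n x \<le> avoid P B k x"
  by (rule lift_Suc_antimono_le[of "\<lambda>k. avoid P B k x"]) (rule avoid_Suc_le)

lemma first_entry_nonneg: "0 \<le> first_entry P A i x y"
  by (induction i arbitrary: x) (simp_all add: P_average_nonneg)

lemma sum_first_entry_0: "(\<Sum>y\<in>A. first_entry P A 0 x y * f y) = (if x \<in> A then f x else 0)"
proof -
  have "(\<Sum>y\<in>A. first_entry P A 0 x y * f y) = (\<Sum>y\<in>A. if y = x \<and> x \<in> A then f y else 0)"
    by (intro sum.cong) auto
  then show ?thesis
    by simp
qed

lemma sum_first_entry_Suc:
  "(\<Sum>y\<in>A. first_entry P A (Suc i) x y * f y) =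
    (if x \<in> A then f x else (\<Sum>z\<in>UNIV. P x z * (\<Sum>y\<in>A. first_entry P A i z y * f y)))"
proof (cases "x \<in> A")
  case True
  then have "(\<Sum>y\<in>A. first_entry P A (Suc i) x y * f y) = (\<Sum>y\<in>A. first_entry P A 0 x y * f y)"
    by (intro sum.cong) auto
  also have "\<dots> = f x"
    by (simp only: sum_first_entry_0 True if_True)
  finally show ?thesis
    using True by simp
next
  case False
  then have "(\<Sum>y\<in>A. first_entry P A (Suc i) x y * f y)
      = (\<Sum>y\<in>A. \<Sum>z\<in>UNIV. P x z * (first_entry P A i z y * f y))"
    by (simp add: sum_distrib_left mult_ac)
  also have "\<dots> = (\<Sum>z\<in>UNIV. P x z * (\<Sum>y\<in>A. first_entry P A i z y * f y))"
    by (subst sum.swap) (simp add: sum_distrib_left)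
  finally show ?thesis
    using False by simp
qed

lemma sum_first_entry_le_1: "(\<Sum>y\<in>A. first_entry P A i x y) \<le> 1"
proof (induction i arbitrary: x)
  case 0
  then show ?case
    using sum_first_entry_0[of A x "\<lambda>_. 1"] by simp
next
  case (Suc i)
  then show ?case
    using sum_first_entry_Suc[of A i x "\<lambda>_. 1"] by (simp add: P_average_le)
qed

lemma first_entry_le_1: "y \<in> A \<Longrightarrow> first_entry P A i x y \<le> 1"
  by (rule order_trans[OF member_le_sum sum_first_entry_le_1]) (auto simp: first_entry_nonneg)

text \<open>Strong Markov property at the first entrance into \<open>A\<close>: a path avoiding \<open>B\<close> for
  \<open>i + j\<close> steps either avoids \<open>A\<close> for \<open>i\<close> steps, or enters \<open>A\<close> at some \<open>y\<close> and then avoids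
  \<open>B\<close> for \<open>j\<close> more steps.\<close>
lemma avoid_add_le:
  "avoid P B (i + j) x \<le> avoid P A i x + (\<Sum>y\<in>A. first_entry P A i x y * avoid P B j y)"
proof (induction i arbitrary: x)
  case 0
  have "(\<Sum>y\<in>A. first_entry P A 0 x y * avoid P B j y) = (if x \<in> A then avoid P B j x else 0)"
    by (rule sum_first_entry_0)
  then show ?case
    using avoid_le_1[of B j x] by (simp del: first_entry.simps)
next
  case (Suc i)
  consider "x \<in> A" | "x \<notin> A" "x \<in> B" | "x \<notin> A" "x \<notin> B"
    by blast
  then show ?case
  proof cases
    case 1
    then have "avoid P A (Suc i) x = 0"
      by simp
    moreover have "(\<Sum>y\<in>A. first_entry P A (Suc i) x y * avoid P B j y) = avoid P B j x"
      using 1 by (simp only: sum_first_entry_Suc if_True)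
    ultimately show ?thesis
      using avoid_antimono[of j "Suc i + j" B x] by simp
  next
    case 2
    then show ?thesis
      using avoid_nonneg[of A "Suc i" x]
      by (simp add: sum_nonneg first_entry_nonneg avoid_nonneg del: first_entry.simps)
  next
    case 3
    then have "avoid P B (Suc i + j) x = (\<Sum>z\<in>UNIV. P x z * avoid P B (i + j) z)"
      by simp
    also have "\<dots> \<le> (\<Sum>z\<in>UNIV. P x z * (avoid P A i z + (\<Sum>y\<in>A. first_entry P A i z y * avoid P B j y)))"
      using Suc.IH by (intro sum_mono mult_left_mono P_nonneg)
    also have "\<dots> = (\<Sum>z\<in>UNIV. P x z * avoid P A i z)
        + (\<Sum>z\<in>UNIV. P x z * (\<Sum>y\<in>A. first_entry P A i z y * avoid P B j y))"
      by (simp add: distrib_left sum.distrib)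
    also have "\<dots> = avoid P A (Suc i) x + (\<Sum>y\<in>A. first_entry P A (Suc i) x y * avoid P B j y)"
      using 3 by (simp only: sum_first_entry_Suc avoid.simps if_False)
    finally show ?thesis .
  qed
qed

lemma mpow_pos_closed:
  assumes closed: "\<And>x y. x \<in> S \<Longrightarrow> 0 < P x y \<Longrightarrow> y \<in> S"
  shows "x \<in> S \<Longrightarrow> 0 < mpow P k x y \<Longrightarrow> y \<in> S"
proof (induction k arbitrary: x)
  case 0
  then show ?case
    by (simp split: if_splits)
next
  case (Suc k)
  then have "0 < (\<Sum>z\<in>UNIV. P x z * mpow P k z y)"
    by simp
  then obtain z where "0 < P x z * mpow P k z y"
    by (meson not_le sum_nonpos)
  then have "0 < P x z" "0 < mpow P k z y"
    using P_nonneg[of x z] mpow_nonneg[of k z y] by (auto simp: zero_less_mult_iff)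
  with Suc closed show ?case
    by blast
qed

lemma irreducible_closed_UNIV:
  assumes "irreducible_chain P" "\<And>x y. x \<in> S \<Longrightarrow> 0 < P x y \<Longrightarrow> y \<in> S" "x \<in> S"
  shows "y \<in> S"
proof -
  obtain k where "0 < mpow P k x y"
    using assms(1) by (auto simp: irreducible_chain_def)
  then show ?thesis
    using mpow_pos_closed[of S x k y] assms(2,3) by blast
qed

text \<open>Maximum principle: the set where a harmonic function attains its maximum is closed under
  transitions.\<close>
lemma harmonic_const:
  assumes "irreducible_chain P" and harmonic: "\<And>x. (\<Sum>y\<in>UNIV. P x y * v y) = v x"
  shows "v x = v y"
proof -
  define M where "M = Max (range v)"
  have le: "v z \<le> M" for z
    by (simp add: M_def)
  have "M \<in> range v"
    unfolding M_def by (intro Max_in) auto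
  then obtain x0 where "v x0 = M"
    by auto
  moreover have "v z = M" if "v x = M" "0 < P x z" for x z
  proof -
    have "(\<Sum>z\<in>UNIV. P x z * (M - v z)) = 0"
      using harmonic[of x] that(1) by (simp add: algebra_simps sum_subtractf sum_distrib_left[symmetric] P_row_sum)
    then have "P x z * (M - v z) = 0"
      by (subst (asm) sum_nonneg_eq_0_iff) (auto intro: mult_nonneg_nonneg P_nonneg simp: le)
    with that(2) show ?thesis
      by simp
  qed
  ultimately have "v z = M" for z
    using irreducible_closed_UNIV[OF assms(1), of "{z. v z = M}" x0 z] by blast
  then show ?thesis
    by simp
qed

lemma eigenvalue_le_1:
  assumes "is_eigenvalue P l"
  shows "l \<le> 1"
proof -
  obtain v where v: "v \<noteq> (\<lambda>_. 0)" "\<forall>x. (\<Sum>y\<in>UNIV. P x y * v y) = l * v x"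
    using assms by (auto simp: is_eigenvalue_def)
  define m where "m = Max (range (\<lambda>x. \<bar>v x\<bar>))"
  have le: "\<bar>v z\<bar> \<le> m" for z
    by (simp add: m_def)
  have "m \<in> range (\<lambda>x. \<bar>v x\<bar>)"
    unfolding m_def by (intro Max_in) auto
  then obtain x0 where x0: "\<bar>v x0\<bar> = m"
    by auto
  obtain x1 where "v x1 \<noteq> 0"
    using v(1) by auto
  then have "0 < m"
    using le[of x1] by simp
  have "\<bar>l\<bar> * m = \<bar>\<Sum>y\<in>UNIV. P x0 y * v y\<bar>"
    using v(2) x0 by (simp add: abs_mult)
  also have "\<dots> \<le> (\<Sum>y\<in>UNIV. P x0 y * \<bar>v y\<bar>)"
    by (rule order_trans[OF sum_abs]) (simp add: abs_mult P_nonneg)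
  also have "\<dots> \<le> 1 * m"
    using P_average_le[of "\<lambda>y. \<bar>v y\<bar>" m x0] le by simp
  finally have "\<bar>l\<bar> \<le> 1"
    using \<open>0 < m\<close> by (rule mult_right_le_imp_le)
  then show ?thesis
    by simp
qed

lemma summable_avoid: "0 \<le> t \<Longrightarrow> summable (\<lambda>k. poisson_weight t k * avoid P B k x)"
  by (rule summable_poisson_weight_bounded) (simp_all add: avoid_nonneg avoid_le_1)

lemma survival_from_nonneg: "0 \<le> t \<Longrightarrow> 0 \<le> survival_from P B t x"
  unfolding survival_from_def
  by (intro suminf_nonneg summable_avoid mult_nonneg_nonneg poisson_weight_nonneg avoid_nonneg)

lemma poisson_first_entry_mass_le_1:
  assumes "0 \<le> t"
  shows "(\<Sum>y\<in>A. \<Sum>i. poisson_weight t i * first_entry P A i x y) \<le> 1"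
proof -
  have summable: "summable (\<lambda>i. poisson_weight t i * first_entry P A i x y)" if "y \<in> A" for y
    using assms that by (intro summable_poisson_weight_bounded) (simp_all add: first_entry_nonneg first_entry_le_1)
  have "(\<Sum>y\<in>A. \<Sum>i. poisson_weight t i * first_entry P A i x y)
      = (\<Sum>i. poisson_weight t i * (\<Sum>y\<in>A. first_entry P A i x y))"
    by (simp add: suminf_sum[symmetric] summable sum_distrib_left)
  also have "\<dots> \<le> (\<Sum>i. poisson_weight t i)"
  proof (rule suminf_le)
    have "\<bar>\<Sum>y\<in>A. first_entry P A i x y\<bar> \<le> 1" for i
      using sum_first_entry_le_1 by (simp add: sum_nonneg first_entry_nonneg)
    then show "summable (\<lambda>i. poisson_weight t i * (\<Sum>y\<in>A. first_entry P A i x y))"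
      using assms by (rule summable_poisson_weight_bounded[rotated])
    show "summable (poisson_weight t)"
      by (rule sums_summable[OF poisson_weight_sums_1])
    show "poisson_weight t i * (\<Sum>y\<in>A. first_entry P A i x y) \<le> poisson_weight t i" for i
      using assms by (intro mult_left_le sum_first_entry_le_1 poisson_weight_nonneg)
  qed
  also have "\<dots> = 1"
    using poisson_weight_sums_1 by (simp add: sums_iff)
  finally show ?thesis .
qed

lemma poisson_avoid_add_le:
  assumes "0 \<le> t" "0 \<le> s"
  shows "poisson_weight (t + s) n * avoid P B n x \<le>
      (\<Sum>i\<le>n. poisson_weight t i * avoid P A i x * poisson_weight s (n - i))
      + (\<Sum>y\<in>A. \<Sum>i\<le>n. poisson_weight t i * first_entry P A i x y *
          (poisson_weight s (n - i) * avoid P B (n - i) y))"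
proof -
  have "poisson_weight (t + s) n * avoid P B n x
      = (\<Sum>i\<le>n. poisson_weight t i * poisson_weight s (n - i) * avoid P B (i + (n - i)) x)"
    by (simp add: poisson_weight_add sum_distrib_right)
  also have "\<dots> \<le> (\<Sum>i\<le>n. poisson_weight t i * poisson_weight s (n - i) *
      (avoid P A i x + (\<Sum>y\<in>A. first_entry P A i x y * avoid P B (n - i) y)))"
    using assms by (intro sum_mono mult_left_mono avoid_add_le mult_nonneg_nonneg poisson_weight_nonneg)
  also have "\<dots> = (\<Sum>i\<le>n. poisson_weight t i * avoid P A i x * poisson_weight s (n - i))
      + (\<Sum>y\<in>A. \<Sum>i\<le>n. poisson_weight t i * first_entry P A i x y *
          (poisson_weight s (n - i) * avoid P B (n - i) y))"
    by (subst sum.swap) (simp add: algebra_simps sum.distrib sum_distrib_left)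
  finally show ?thesis .
qed

text \<open>The strong Markov property at the entrance into \<open>A\<close>, in continuous time: the Poisson
  weights of \<open>t + s\<close> are the Cauchy product of those of \<open>t\<close> and \<open>s\<close>.\<close>
lemma survival_from_add_le:
  assumes "0 \<le> t" "0 \<le> s" "0 \<le> \<epsilon>" and from_A: "\<And>y. y \<in> A \<Longrightarrow> survival_from P B s y \<le> \<epsilon>"
  shows "survival_from P B (t + s) x \<le> survival_from P A t x + \<epsilon>"
proof -
  define entry_mass where "entry_mass y = (\<Sum>i. poisson_weight t i * first_entry P A i x y)" for y
  have total: "(\<lambda>n. poisson_weight (t + s) n * avoid P B n x) sums survival_from P B (t + s) x"
    using assms by (simp add: survival_from_def summable_sums summable_avoid)
  have avoid_A: "(\<lambda>n. \<Sum>i\<le>n. poisson_weight t i * avoid P A i x * poisson_weight s (n - i))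
      sums survival_from P A t x"
    using poisson_mixture_product_sums[of t s "\<lambda>i. avoid P A i x" "\<lambda>_. 1"] assms
      sums_unique[OF poisson_weight_sums_1]
    by (simp add: survival_from_def avoid_nonneg avoid_le_1)
  have enter_A: "(\<lambda>n. \<Sum>y\<in>A. \<Sum>i\<le>n. poisson_weight t i * first_entry P A i x y *
        (poisson_weight s (n - i) * avoid P B (n - i) y))
      sums (\<Sum>y\<in>A. entry_mass y * survival_from P B s y)"
    using assms unfolding entry_mass_def survival_from_def
    by (intro sums_sum poisson_mixture_product_sums)
      (simp_all add: first_entry_nonneg first_entry_le_1 avoid_nonneg avoid_le_1)
  have "survival_from P B (t + s) x \<le> survival_from P A t x + (\<Sum>y\<in>A. entry_mass y * survival_from P B s y)"
    using sums_le[OF _ total sums_add[OF avoid_A enter_A]] poisson_avoid_add_le[OF assms(1,2)] by simp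
  also have "(\<Sum>y\<in>A. entry_mass y * survival_from P B s y) \<le> (\<Sum>y\<in>A. entry_mass y * \<epsilon>)"
    using assms from_A unfolding entry_mass_def
    by (intro sum_mono mult_left_mono suminf_nonneg summable_poisson_weight_bounded mult_nonneg_nonneg
        poisson_weight_nonneg first_entry_nonneg) (simp_all add: first_entry_nonneg first_entry_le_1)
  also have "\<dots> = (\<Sum>y\<in>A. entry_mass y) * \<epsilon>"
    by (simp add: sum_distrib_right)
  also have "\<dots> \<le> 1 * \<epsilon>"
    using poisson_first_entry_mass_le_1[OF assms(1), of A x] assms(3)
    unfolding entry_mass_def by (rule mult_right_mono)
  finally show ?thesis
    by simp
qed

lemma survival_add_le:
  assumes "prob_dist \<mu>" "0 \<le> t" "0 \<le> s" "0 \<le> \<epsilon>" "\<And>y. y \<in> A \<Longrightarrow> survival_from P B s y \<le> \<epsilon>"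
  shows "survival P \<mu> B (t + s) \<le> survival P \<mu> A t + \<epsilon>"
proof -
  have "survival P \<mu> B (t + s) \<le> (\<Sum>x\<in>UNIV. \<mu> x * (survival_from P A t x + \<epsilon>))"
    unfolding survival_eq_sum_survival_from using assms
    by (intro sum_mono mult_left_mono survival_from_add_le) (auto simp: prob_dist_def)
  also have "\<dots> = survival P \<mu> A t + \<epsilon>"
    using assms(1)
    by (simp add: survival_eq_sum_survival_from prob_dist_def distrib_left sum.distrib sum_distrib_right[symmetric])
  finally show ?thesis .
qed

end

locale reversible_chain = markov_chain P
  for P :: "'a::finite \<Rightarrow> 'a \<Rightarrow> real" +
  fixes \<pi> :: "'a \<Rightarrow> real"
  assumes irreducible: "irreducible_chain P"
    and prob_dist_pi: "prob_dist \<pi>"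
    and reversible: "reversible_wrt P \<pi>"
begin

lemma pi_nonneg: "0 \<le> \<pi> x"
  using prob_dist_pi by (simp add: prob_dist_def)

lemma sum_pi: "(\<Sum>x\<in>UNIV. \<pi> x) = 1"
  using prob_dist_pi by (simp add: prob_dist_def)

lemma detailed_balance: "\<pi> x * P x y = \<pi> y * P y x"
  using reversible by (simp add: reversible_wrt_def)

lemma pi_pos: "0 < \<pi> x"
proof -
  obtain x0 where "0 < \<pi> x0"
    using sum_pi by (metis not_le sum_nonpos zero_less_one)
  moreover have "0 < \<pi> y" if "0 < \<pi> x" "0 < P x y" for x y
    using detailed_balance[of x y] that pi_nonneg[of y] by (auto simp: less_le)
  ultimately show ?thesis
    using irreducible_closed_UNIV[OF irreducible, of "{x. 0 < \<pi> x}" x0 x] by blast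
qed

lemma pi_neq_0 [simp]: "\<pi> x \<noteq> 0"
  using pi_pos[of x] by simp

lemma sum_pi_le_1: "sum \<pi> B \<le> 1"
  using sum_mono2[of UNIV B \<pi>] pi_nonneg sum_pi by auto

text \<open>The symmetrisation \<open>D^(1/2) P D^(-1/2)\<close> of \<open>P\<close>, where \<open>D = diag \<pi>\<close>; reversibility
  makes it a symmetric matrix.\<close>
definition sym_P :: "real^'a^'a" where
  "sym_P = (\<chi> x y. sqrt (\<pi> x) * P x y / sqrt (\<pi> y))"

definition sqrt_pi :: "real^'a" where
  "sqrt_pi = (\<chi> x. sqrt (\<pi> x))"

definition sqrt_pi_off :: "'a set \<Rightarrow> real^'a" where
  "sqrt_pi_off B = (\<chi> x. if x \<in> B then 0 else sqrt (\<pi> x))"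

lemma transpose_sym_P: "transpose sym_P = sym_P"
proof -
  have "sqrt (\<pi> y) * P y x / sqrt (\<pi> x) = sqrt (\<pi> x) * P x y / sqrt (\<pi> y)" for x y
  proof -
    have "sqrt (\<pi> y) * P y x / sqrt (\<pi> x) = \<pi> y * P y x / (sqrt (\<pi> x) * sqrt (\<pi> y))"
      using pi_pos[of x] pi_pos[of y] by (simp add: field_simps)
    also have "\<dots> = sqrt (\<pi> x) * P x y / sqrt (\<pi> y)"
      using pi_pos[of x] pi_pos[of y] by (simp add: detailed_balance field_simps)
    finally show ?thesis .
  qed
  then show ?thesis
    by (simp add: transpose_def sym_P_def vec_eq_iff)
qed

lemma sym_P_eigen_iff:
  "sym_P *v g = l *\<^sub>R g \<longleftrightarrow> (\<forall>x. (\<Sum>y\<in>UNIV. P x y * (g $ y / sqrt (\<pi> y))) = l * (g $ x / sqrt (\<pi> x)))"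
proof -
  have "(sym_P *v g) $ x = sqrt (\<pi> x) * (\<Sum>y\<in>UNIV. P x y * (g $ y / sqrt (\<pi> y)))" for x
    by (simp add: sym_P_def matrix_vector_mult_def sum_distrib_left mult_ac)
  moreover have "sqrt (\<pi> x) * a = l * g $ x \<longleftrightarrow> a = l * (g $ x / sqrt (\<pi> x))" for x a
    using pi_pos[of x] by (auto simp: field_simps)
  ultimately show ?thesis
    by (simp add: vec_eq_iff)
qed

lemma sym_P_sqrt_pi: "sym_P *v sqrt_pi = sqrt_pi"
proof -
  have "sym_P *v sqrt_pi = 1 *\<^sub>R sqrt_pi"
    unfolding sym_P_eigen_iff using pi_pos by (simp add: sqrt_pi_def P_row_sum)
  then show ?thesis
    by simp
qed

lemma inner_sqrt_pi: "sqrt_pi \<bullet> sqrt_pi = 1"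
  by (simp add: sqrt_pi_def inner_vec_def pi_nonneg sum_pi)

lemma inner_sqrt_pi_off: "sqrt_pi_off B \<bullet> sqrt_pi_off B = 1 - sum \<pi> B"
proof -
  have "sqrt_pi_off B \<bullet> sqrt_pi_off B = (\<Sum>x\<in>UNIV - B. \<pi> x)"
    by (simp add: sqrt_pi_off_def inner_vec_def pi_nonneg if_distrib sum.If_cases Diff_eq)
  then show ?thesis
    by (simp add: sum_diff sum_pi)
qed

lemma is_eigenvalue_iff: "is_eigenvalue P l \<longleftrightarrow> (\<exists>g. g \<noteq> 0 \<and> sym_P *v g = l *\<^sub>R g)"
proof
  assume "is_eigenvalue P l"
  then obtain v where v: "v \<noteq> (\<lambda>_. 0)" "\<forall>x. (\<Sum>y\<in>UNIV. P x y * v y) = l * v x"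
    by (auto simp: is_eigenvalue_def)
  define g where "g = (\<chi> x. sqrt (\<pi> x) * v x)"
  obtain x where "v x \<noteq> 0"
    using v(1) by auto
  then have "g $ x \<noteq> 0"
    using pi_pos[of x] by (simp add: g_def)
  then have "g \<noteq> 0"
    by auto
  moreover have "sym_P *v g = l *\<^sub>R g"
    using v(2) pi_pos by (simp add: sym_P_eigen_iff g_def)
  ultimately show "\<exists>g. g \<noteq> 0 \<and> sym_P *v g = l *\<^sub>R g"
    by blast
next
  assume "\<exists>g. g \<noteq> 0 \<and> sym_P *v g = l *\<^sub>R g"
  then obtain g where "g \<noteq> 0" "sym_P *v g = l *\<^sub>R g"
    by blast
  moreover from \<open>g \<noteq> 0\<close> have "(\<lambda>y. g $ y / sqrt (\<pi> y)) \<noteq> (\<lambda>_. 0)"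
    using pi_pos by (auto simp: vec_eq_iff dest: fun_cong)
  ultimately show "is_eigenvalue P l"
    unfolding is_eigenvalue_def sym_P_eigen_iff by blast
qed

lemma eigenvalues_finite: "finite {l. is_eigenvalue P l}"
  using symmetric_matrix_eigenvalues_finite[OF transpose_sym_P] by (simp add: is_eigenvalue_iff)

lemma le_lambda2: "is_eigenvalue P l \<Longrightarrow> l \<noteq> 1 \<Longrightarrow> l \<le> lambda2 P"
  unfolding lambda2_def by (rule Max_ge) (auto intro: finite_subset[OF _ eigenvalues_finite])

lemma orthogonal_sqrt_pi_sym_P: "orthogonal sqrt_pi v \<Longrightarrow> orthogonal sqrt_pi (sym_P *v v)"
  using symmetric_matrix_inner[OF transpose_sym_P, of sqrt_pi v]
  by (simp add: orthogonal_def sym_P_sqrt_pi)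

text \<open>Irreducibility makes the eigenvalue \<open>1\<close> simple, with eigenvector \<open>sqrt_pi\<close>.\<close>
lemma eigenvector_orthogonal_sqrt_pi:
  assumes "g \<noteq> 0" "orthogonal sqrt_pi g" "sym_P *v g = l *\<^sub>R g"
  shows "is_eigenvalue P l" "l \<noteq> 1"
proof -
  show "is_eigenvalue P l"
    using assms(1,3) is_eigenvalue_iff by blast
  show "l \<noteq> 1"
  proof
    assume "l = 1"
    then have harmonic: "\<forall>x. (\<Sum>y\<in>UNIV. P x y * (g $ y / sqrt (\<pi> y))) = g $ x / sqrt (\<pi> x)"
      using assms(3) sym_P_eigen_iff[of g 1] by simp
    fix x0 :: 'a
    define c where "c = g $ x0 / sqrt (\<pi> x0)"
    have "g = c *\<^sub>R sqrt_pi"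
      using harmonic_const[OF irreducible, of "\<lambda>y. g $ y / sqrt (\<pi> y)"] harmonic
      by (simp add: vec_eq_iff sqrt_pi_def c_def field_simps)
    with assms(2) have "c = 0"
      by (simp add: orthogonal_def inner_sqrt_pi)
    with \<open>g = c *\<^sub>R sqrt_pi\<close> assms(1) show False
      by simp
  qed
qed

lemma lambda2_lt_1:
  assumes "card (UNIV :: 'a set) \<ge> 2"
  shows "lambda2 P < 1"
proof -
  obtain a b :: 'a where "a \<noteq> b"
    using assms by (metis card_2_iff' card_le_Suc0_iff_eq finite not_less_eq_eq numeral_2_eq_2)
  define h where "h = (\<chi> x. if x = a then sqrt (\<pi> b) else if x = b then - sqrt (\<pi> a) else 0)"
  have "h $ a \<noteq> 0"
    by (simp add: h_def)
  then have "h \<noteq> 0"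
    by auto
  moreover have "orthogonal sqrt_pi h"
    using \<open>a \<noteq> b\<close> by (simp add: orthogonal_def inner_vec_def sqrt_pi_def h_def if_distrib sum.If_cases)
  ultimately obtain e l where "e \<in> {v. orthogonal sqrt_pi v}" "e \<noteq> 0" "sym_P *v e = l *\<^sub>R e"
    using symmetric_matrix_eigenvector_in_subspace[OF transpose_sym_P subspace_orthogonal_to_vector]
      orthogonal_sqrt_pi_sym_P by blast
  then have "is_eigenvalue P l" "l \<noteq> 1"
    using eigenvector_orthogonal_sqrt_pi by auto
  then have "lambda2 P \<in> {l. is_eigenvalue P l \<and> l \<noteq> 1}"
    unfolding lambda2_def by (intro Max_in) (auto intro: finite_subset[OF _ eigenvalues_finite])
  then show ?thesis
    using eigenvalue_le_1 by force
qed

lemma spectral_gap: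
  assumes "orthogonal sqrt_pi h"
  shows "h \<bullet> (sym_P *v h) \<le> lambda2 P * (h \<bullet> h)"
  using symmetric_matrix_quadratic_form_le[OF transpose_sym_P subspace_orthogonal_to_vector, of sqrt_pi]
    orthogonal_sqrt_pi_sym_P eigenvector_orthogonal_sqrt_pi le_lambda2 assms
  by blast

text \<open>The Dirichlet-form bound for functions vanishing on \<open>B\<close>: only the component along
  \<open>sqrt_pi\<close> escapes the spectral gap, and it is controlled by Cauchy--Schwarz against
  \<open>sqrt_pi_off B\<close>.\<close>
lemma quadratic_form_vanishing_on_le:
  assumes "lambda2 P \<le> 1" and vanish: "\<forall>x\<in>B. g $ x = 0"
  shows "g \<bullet> (sym_P *v g) \<le> (1 - (1 - lambda2 P) * sum \<pi> B) * (g \<bullet> g)"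
proof -
  define c where "c = g \<bullet> sqrt_pi"
  define h where "h = g - c *\<^sub>R sqrt_pi"
  have h: "orthogonal sqrt_pi h"
    by (simp add: orthogonal_def h_def c_def inner_diff_right inner_sqrt_pi inner_commute)
  then have "sqrt_pi \<bullet> (sym_P *v h) = 0"
    using orthogonal_sqrt_pi_sym_P by (simp add: orthogonal_def)
  then have "g \<bullet> (sym_P *v g) = h \<bullet> (sym_P *v h) + c\<^sup>2" and "g \<bullet> g = h \<bullet> h + c\<^sup>2"
    using h unfolding h_def
    by (simp_all add: orthogonal_def matrix_vector_mult_diff_distrib matrix_vector_mult_scaleR sym_P_sqrt_pi
        inner_diff_left inner_diff_right inner_sqrt_pi inner_commute c_def power2_eq_square algebra_simps)
  moreover have "c = g \<bullet> sqrt_pi_off B"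
    unfolding c_def inner_vec_def sqrt_pi_def sqrt_pi_off_def using vanish by (intro sum.cong) auto
  then have "c\<^sup>2 \<le> (g \<bullet> g) * (1 - sum \<pi> B)"
    using Cauchy_Schwarz_ineq[of g "sqrt_pi_off B"] by (simp add: inner_sqrt_pi_off)
  ultimately show ?thesis
    using spectral_gap[OF h] assms(1)
      mult_left_mono[of "c\<^sup>2" "(g \<bullet> g) * (1 - sum \<pi> B)" "1 - lambda2 P"]
    by (simp add: algebra_simps)
qed

definition killed_sym_P :: "'a set \<Rightarrow> real^'a^'a" where
  "killed_sym_P B = (\<chi> x y. if x \<notin> B \<and> y \<notin> B then sym_P $ x $ y else 0)"

definition vanishing_on :: "'a set \<Rightarrow> (real^'a) set" where
  "vanishing_on B = {g. \<forall>x\<in>B. g $ x = 0}"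

lemma transpose_killed_sym_P: "transpose (killed_sym_P B) = killed_sym_P B"
  using transpose_sym_P by (auto simp: killed_sym_P_def transpose_def vec_eq_iff)

lemma subspace_vanishing_on: "subspace (vanishing_on B)"
  by (simp add: subspace_def vanishing_on_def)

lemma killed_sym_P_vanishing_on: "killed_sym_P B *v g \<in> vanishing_on B"
  by (simp add: vanishing_on_def killed_sym_P_def matrix_vector_mult_def)

lemma inner_killed_sym_P:
  "g \<in> vanishing_on B \<Longrightarrow> g \<bullet> (killed_sym_P B *v g) = g \<bullet> (sym_P *v g)"
  unfolding vanishing_on_def inner_vec_def matrix_vector_mult_def killed_sym_P_def
  by (intro sum.cong refl) (auto intro!: sum.cong)

lemma killed_sym_P_power:
  "((*v) (killed_sym_P B) ^^ k) (sqrt_pi_off B) = (\<chi> x. sqrt (\<pi> x) * avoid P B k x)"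
proof (induction k)
  case 0
  then show ?case
    by (simp add: sqrt_pi_off_def vec_eq_iff)
next
  case (Suc k)
  have "(\<Sum>y\<in>UNIV. (if x \<notin> B \<and> y \<notin> B then sym_P $ x $ y else 0) * (sqrt (\<pi> y) * avoid P B k y))
      = sqrt (\<pi> x) * avoid P B (Suc k) x" for x
    by (cases "x \<in> B") (auto simp: sym_P_def sum_distrib_left avoid_eq_0 intro!: sum.cong)
  with Suc show ?case
    by (simp add: killed_sym_P_def matrix_vector_mult_def vec_eq_iff)
qed

lemma survival_stationary_le:
  assumes "0 \<le> s" "lambda2 P \<le> 1"
  shows "survival P \<pi> B s \<le> (1 - sum \<pi> B) * exp (- (s * ((1 - lambda2 P) * sum \<pi> B)))"
proof -
  let ?K = "killed_sym_P B" and ?m = "1 - (1 - lambda2 P) * sum \<pi> B"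
  have pi_avoid: "(\<Sum>x\<in>UNIV. \<pi> x * avoid P B k x) = sqrt_pi_off B \<bullet> ((*v) ?K ^^ k) (sqrt_pi_off B)" for k
    unfolding killed_sym_P_power inner_vec_def
    by (intro sum.cong refl) (simp add: sqrt_pi_off_def avoid_eq_0 mult.assoc[symmetric] pi_nonneg)
  have "survival P \<pi> B s = (\<Sum>k. poisson_weight s k * (\<Sum>x\<in>UNIV. \<pi> x * avoid P B k x))"
    using assms(1)
    by (simp add: survival_eq_sum_survival_from survival_from_def suminf_mult[symmetric] summable_avoid
        suminf_sum[symmetric] summable_mult sum_distrib_left mult_ac)
  also have "\<dots> \<le> exp (- (s * (1 - ?m))) * (sqrt_pi_off B \<bullet> sqrt_pi_off B)"
    unfolding pi_avoid
  proof (rule symmetric_matrix_poisson_form_le[OF transpose_killed_sym_P subspace_vanishing_on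
        killed_sym_P_vanishing_on _ _ assms(1)])
    show "sqrt_pi_off B \<in> vanishing_on B"
      by (simp add: vanishing_on_def sqrt_pi_off_def)
    fix e c assume e: "e \<in> vanishing_on B" "e \<noteq> 0" "?K *v e = c *\<^sub>R e"
    then have "c * (e \<bullet> e) = e \<bullet> (sym_P *v e)"
      using inner_killed_sym_P[OF e(1)] by simp
    also have "\<dots> \<le> ?m * (e \<bullet> e)"
      using quadratic_form_vanishing_on_le[OF assms(2)] e(1) by (simp add: vanishing_on_def)
    finally show "c \<le> ?m"
      using e(2) by simp
  qed
  finally show ?thesis
    by (simp add: inner_sqrt_pi_off mult.commute)
qed

end

lemma cInf_le_cInf_add:
  fixes A B :: "real set"
  assumes "A \<noteq> {}" "bdd_below B" "\<And>t. t \<in> A \<Longrightarrow> t + s \<in> B"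
  shows "Inf B \<le> Inf A + s"
proof -
  have "Inf B - s \<le> Inf A"
  proof (rule cInf_greatest[OF assms(1)])
    fix t assume "t \<in> A"
    then show "Inf B - s \<le> t"
      using cInf_lower[OF assms(3)[OF \<open>t \<in> A\<close>] assms(2)] by simp
  qed
  then show ?thesis
    by simp
qed

definition hitting_times ::
    "('a::finite \<Rightarrow> 'a \<Rightarrow> real) \<Rightarrow> ('a \<Rightarrow> real) \<Rightarrow> real \<Rightarrow> ('a \<Rightarrow> real) \<Rightarrow> real \<Rightarrow> real set"
  where
  "hitting_times P \<pi> \<delta> \<mu> q = {t. 0 \<le> t \<and> (\<forall>B. \<delta> \<le> sum \<pi> B \<longrightarrow> survival P \<mu> B t \<le> q)}"

lemma hit_eq_Inf_hitting_times: "hit P \<pi> \<delta> \<mu> q = Inf (hitting_times P \<pi> \<delta> \<mu> q)"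
  by (simp add: hit_def hitting_times_def)

lemma bdd_below_hitting_times: "bdd_below (hitting_times P \<pi> \<delta> \<mu> q)"
  by (rule bdd_belowI[of _ 0]) (simp add: hitting_times_def)

lemma hitting_times_mono: "\<beta> \<le> \<gamma> \<Longrightarrow> hitting_times P \<pi> \<beta> \<mu> q \<subseteq> hitting_times P \<pi> \<gamma> \<mu> q"
  by (auto simp: hitting_times_def)

context reversible_chain
begin

lemma pi_survival_from_le: "0 \<le> t \<Longrightarrow> \<pi> x * survival_from P B t x \<le> survival P \<pi> B t"
  unfolding survival_eq_sum_survival_from
  by (rule member_le_sum) (simp_all add: pi_nonneg survival_from_nonneg)

lemma markov_inequality_survival_from:
  assumes "0 \<le> t"
  shows "\<epsilon> * sum \<pi> {x. \<epsilon> < survival_from P B t x} \<le> survival P \<pi> B t"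
proof -
  have "\<epsilon> * sum \<pi> {x. \<epsilon> < survival_from P B t x} \<le> (\<Sum>x\<in>{x. \<epsilon> < survival_from P B t x}. \<pi> x * survival_from P B t x)"
    unfolding sum_distrib_left
  proof (rule sum_mono)
    fix x assume "x \<in> {x. \<epsilon> < survival_from P B t x}"
    then show "\<epsilon> * \<pi> x \<le> \<pi> x * survival_from P B t x"
      using pi_nonneg[of x] mult_right_mono[of \<epsilon> "survival_from P B t x" "\<pi> x"]
      by (simp add: mult.commute)
  qed
  also have "\<dots> \<le> survival P \<pi> B t"
    unfolding survival_eq_sum_survival_from using assms
    by (intro sum_mono2) (simp_all add: pi_nonneg survival_from_nonneg)
  finally show ?thesis .
qed

lemma survival_le_exp:
  assumes "card (UNIV :: 'a set) \<ge> 2" "prob_dist \<mu>" "0 \<le> t" "\<delta> \<le> sum \<pi> B"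
  shows "survival P \<mu> B t \<le> (\<Sum>x\<in>UNIV. \<mu> x / \<pi> x) * exp (- (t * ((1 - lambda2 P) * \<delta>)))"
proof -
  have gap: "0 < 1 - lambda2 P"
    using lambda2_lt_1[OF assms(1)] by simp
  have "survival_from P B t x \<le> exp (- (t * ((1 - lambda2 P) * \<delta>))) / \<pi> x" for x
  proof -
    have "\<pi> x * survival_from P B t x \<le> (1 - sum \<pi> B) * exp (- (t * ((1 - lambda2 P) * sum \<pi> B)))"
      using order_trans[OF pi_survival_from_le[OF assms(3)] survival_stationary_le[OF assms(3)]] gap
      by simp
    also have "\<dots> \<le> 1 * exp (- (t * ((1 - lambda2 P) * \<delta>)))"
      using assms(3,4) gap sum_nonneg[of B \<pi>] pi_nonneg
      by (intro mult_mono) (auto intro!: mult_left_mono)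
    finally show ?thesis
      using pi_pos[of x] by (simp add: field_simps)
  qed
  then have "survival P \<mu> B t \<le> (\<Sum>x\<in>UNIV. \<mu> x * (exp (- (t * ((1 - lambda2 P) * \<delta>))) / \<pi> x))"
    unfolding survival_eq_sum_survival_from using assms(2)
    by (intro sum_mono mult_left_mono) (auto simp: prob_dist_def)
  then show ?thesis
    by (simp add: sum_distrib_right)
qed

lemma hitting_times_nonempty:
  assumes "card (UNIV :: 'a set) \<ge> 2" "prob_dist \<mu>" "0 < \<delta>" "0 < q"
  shows "hitting_times P \<pi> \<delta> \<mu> q \<noteq> {}"
proof -
  define C where "C = (\<Sum>x\<in>UNIV. \<mu> x / \<pi> x)"
  define a where "a = (1 - lambda2 P) * \<delta>"
  define t where "t = max 0 (ln ((C + 1) / q)) / a"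
  have "0 \<le> C"
    using assms(2) pi_nonneg by (auto simp: C_def prob_dist_def intro!: sum_nonneg)
  have "0 < a"
    using lambda2_lt_1[OF assms(1)] assms(3) by (simp add: a_def)
  then have "0 \<le> t" "ln ((C + 1) / q) \<le> t * a"
    by (simp_all add: t_def)
  then have "exp (- (t * a)) \<le> exp (- ln ((C + 1) / q))"
    by simp
  also have "\<dots> = q / (C + 1)"
    using \<open>0 \<le> C\<close> assms(4) by (simp add: exp_minus)
  finally have "C * exp (- (t * a)) \<le> C * (q / (C + 1))"
    using \<open>0 \<le> C\<close> by (rule mult_left_mono)
  also have "\<dots> \<le> q"
    using \<open>0 \<le> C\<close> assms(4) by (simp add: field_simps)
  finally have "t \<in> hitting_times P \<pi> \<delta> \<mu> q"
    using survival_le_exp[OF assms(1,2) \<open>0 \<le> t\<close>] \<open>0 \<le> t\<close>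
    by (auto simp: hitting_times_def C_def a_def intro: order_trans)
  then show ?thesis
    by blast
qed

text \<open>Markov's inequality applied to the stationary decay bound.\<close>
lemma fast_entry_set_large:
  assumes "lambda2 P \<le> 1" "0 \<le> s" "0 < \<epsilon>" "\<beta> \<le> sum \<pi> B"
    and decay: "(1 - \<beta>) * exp (- (s * ((1 - lambda2 P) * \<beta>))) \<le> (1 - \<gamma>) * \<epsilon>"
  shows "\<gamma> \<le> sum \<pi> {x. survival_from P B s x \<le> \<epsilon>}"
proof -
  have "\<epsilon> * sum \<pi> {x. \<epsilon> < survival_from P B s x} \<le> survival P \<pi> B s"
    by (rule markov_inequality_survival_from[OF assms(2)])
  also have "\<dots> \<le> (1 - sum \<pi> B) * exp (- (s * ((1 - lambda2 P) * sum \<pi> B)))"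
    by (rule survival_stationary_le[OF assms(2,1)])
  also have "\<dots> \<le> (1 - \<beta>) * exp (- (s * ((1 - lambda2 P) * \<beta>)))"
    using assms(1,2,4) sum_pi_le_1[of B]
    by (intro mult_mono) (auto intro!: mult_left_mono)
  also note decay
  finally have "\<epsilon> * sum \<pi> {x. \<epsilon> < survival_from P B s x} \<le> \<epsilon> * (1 - \<gamma>)"
    by (simp add: mult.commute)
  then have "sum \<pi> {x. \<epsilon> < survival_from P B s x} \<le> 1 - \<gamma>"
    using assms(3) by (rule mult_left_le_imp_le)
  moreover have "sum \<pi> {x. survival_from P B s x \<le> \<epsilon>} + sum \<pi> {x. \<epsilon> < survival_from P B s x} = 1"
    using sum.union_disjoint[of "{x. survival_from P B s x \<le> \<epsilon>}" "{x. \<epsilon> < survival_from P B s x}" \<pi>]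
    by (simp add: sum_pi Un_def not_le[symmetric] Int_def)
  ultimately show ?thesis
    by simp
qed

lemma shift_time_decay:
  assumes "card (UNIV :: 'a set) \<ge> 2" "0 < \<epsilon>" "\<epsilon> < 1" "0 < \<beta>" "\<beta> \<le> \<gamma>" "\<gamma> < 1"
  defines "s \<equiv> (1 / \<beta>) * t_rel P * ln ((1 - \<beta>) / ((1 - \<gamma>) * \<epsilon>))"
  shows "0 \<le> s" "(1 - \<beta>) * exp (- (s * ((1 - lambda2 P) * \<beta>))) = (1 - \<gamma>) * \<epsilon>"
proof -
  define R where "R = (1 - \<beta>) / ((1 - \<gamma>) * \<epsilon>)"
  have gap: "0 < 1 - lambda2 P"
    using lambda2_lt_1[OF assms(1)] by simp
  have "(1 - \<gamma>) * \<epsilon> \<le> (1 - \<gamma>) * 1"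
    using assms(3,6) by (intro mult_left_mono) auto
  then have "(1 - \<gamma>) * \<epsilon> \<le> 1 - \<beta>"
    using assms(5) by simp
  then have "1 \<le> R"
    using assms(2-6) by (simp add: R_def)
  then show "0 \<le> s"
    using gap assms(4) by (simp add: s_def R_def[symmetric] t_rel_def)
  have "s * ((1 - lambda2 P) * \<beta>) = ln R"
    using gap assms(4) by (simp add: s_def R_def t_rel_def)
  then have "exp (- (s * ((1 - lambda2 P) * \<beta>))) = 1 / R"
    using \<open>1 \<le> R\<close> by (simp add: exp_minus inverse_eq_divide)
  then show "(1 - \<beta>) * exp (- (s * ((1 - lambda2 P) * \<beta>))) = (1 - \<gamma>) * \<epsilon>"
    using assms(2-6) by (simp add: R_def)
qed

lemma hitting_times_shift:
  assumes "card (UNIV :: 'a set) \<ge> 2" "prob_dist \<mu>"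
    and "0 < \<epsilon>" "\<epsilon> < 1" "0 < \<beta>" "\<beta> \<le> \<gamma>" "\<gamma> < 1"
    and t: "t \<in> hitting_times P \<pi> \<gamma> \<mu> (\<delta> - \<epsilon>)"
  shows "t + (1 / \<beta>) * t_rel P * ln ((1 - \<beta>) / ((1 - \<gamma>) * \<epsilon>)) \<in> hitting_times P \<pi> \<beta> \<mu> \<delta>"
    (is "t + ?s \<in> _")
proof -
  note s = shift_time_decay[OF assms(1,3-7)]
  have "survival P \<mu> B (t + ?s) \<le> \<delta>" if "\<beta> \<le> sum \<pi> B" for B
  proof -
    define A where "A = {x. survival_from P B ?s x \<le> \<epsilon>}"
    have "\<gamma> \<le> sum \<pi> A"
      unfolding A_def using lambda2_lt_1[OF assms(1)] s assms(3) that
      by (intro fast_entry_set_large) auto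
    then have "survival P \<mu> A t \<le> \<delta> - \<epsilon>"
      using t by (simp add: hitting_times_def)
    moreover have "survival P \<mu> B (t + ?s) \<le> survival P \<mu> A t + \<epsilon>"
      using t assms(2,3) s(1) by (intro survival_add_le) (auto simp: A_def hitting_times_def)
    ultimately show ?thesis
      by simp
  qed
  then show ?thesis
    using t s(1) by (simp add: hitting_times_def)
qed

end

theorem corollary4p3:
  fixes P :: "'a::finite \<Rightarrow> 'a \<Rightarrow> real" and \<pi> \<mu> :: "'a \<Rightarrow> real"
    and \<epsilon> \<delta> \<beta> \<gamma> :: real
  assumes "card (UNIV :: 'a set) \<ge> 2"
    and "stochastic P" and "irreducible_chain P"
    and "prob_dist \<pi>" and "reversible_wrt P \<pi>"
    and "prob_dist \<mu>"
    and "0 < \<epsilon>" and "\<epsilon> < \<delta>" and "\<delta> < 1"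
    and "0 < \<beta>" and "\<beta> \<le> \<gamma>" and "\<gamma> < 1"
  shows "hit P \<pi> \<gamma> \<mu> \<delta> \<le> hit P \<pi> \<beta> \<mu> \<delta>
       \<and> hit P \<pi> \<beta> \<mu> \<delta> \<le> hit P \<pi> \<gamma> \<mu> (\<delta> - \<epsilon>)
            + (1 / \<beta>) * t_rel P * ln ((1 - \<beta>) / ((1 - \<gamma>) * \<epsilon>))"
proof
  interpret reversible_chain P \<pi>
    using assms(2-5) by unfold_locales
  show "hit P \<pi> \<gamma> \<mu> \<delta> \<le> hit P \<pi> \<beta> \<mu> \<delta>"
    unfolding hit_eq_Inf_hitting_times
    using assms
    by (intro cInf_superset_mono hitting_times_nonempty bdd_below_hitting_times hitting_times_mono) auto
  show "hit P \<pi> \<beta> \<mu> \<delta> \<le> hit P \<pi> \<gamma> \<mu> (\<delta> - \<epsilon>)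
      + (1 / \<beta>) * t_rel P * ln ((1 - \<beta>) / ((1 - \<gamma>) * \<epsilon>))"
    unfolding hit_eq_Inf_hitting_times
    using hitting_times_nonempty bdd_below_hitting_times hitting_times_shift assms
    by (intro cInf_le_cInf_add) auto
qed

end
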